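(* Let $S_1$ be a signed graph on $n_1$ vertices with adjacency eigenvalues (with multiplicity) $\theta_1(S_1),\dots,\theta_{n_1}(S_1)$, and let $S_2$ be an $r_2$-net regular signed graph on $n_2$ vertices with adjacency eigenvalues (with multiplicity) $\theta_1(S_2),\dots,\theta_{n_2}(S_2)$, where $\theta_k(S_2)=r_2$ for a fixed index $k$, $1\le k\le n_2$. Then the adjacency spectrum (as a multiset) of $S_1\star_s S_2$ consists of: (i) the eigenvalue $\theta_j(S_2)$ with multiplicity $n_1$, for every $j\in\{1,\dots,n_2\}$ with $j\ne k$; (ii) the two eigenvalues $$\frac{\theta_i(S_1)+r_2\pm\sqrt{(1+4n_2)\theta_i(S_1)^2+\left(r_2-2\theta_i(S_1)\right)r_2}}{2}$$ for each $i=1,\dots,n_1$.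
   Context: A signed graph $S=(G,\sigma)$ is a finite simple graph $G$ with a sign function $\sigma:E_G\to\{-1,1\}$. Its adjacency matrix $A_S$ has $(i,j)$ entry $\sigma(v_iv_j)$ if $v_i\sim v_j$ and $0$ otherwise; adjacency eigenvalues/spectrum are those of $A_S$. The net-degree of a vertex is the number of positive edges minus the number of negative edges incident with it; $S$ is $r$-net regular if every vertex has net-degree $r$. The s-neighbourhood corona $S_1\star_s S_2$ of signed graphs $S_1=(G_1,\sigma_1)$ (vertices $v_1,\dots,v_{n_1}$) and $S_2$ (with $n_2$ vertices) is the signed graph on $n_1(n_2+1)$ vertices obtained by taking one copy of $S_1$ and $n_1$ disjoint copies of $S_2$, and, for each $i$ and each neighbour $v_h$ of $v_i$ in $S_1$, joining $v_h$ to every vertex of the $i$th copy of $S_2$ by an edge of sign $\sigma_1(v_hv_i)$. *)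

theory Defs
  imports Jordan_Normal_Form.Char_Poly "HOL-Library.Multiset"
begin

(* The vertices come as a list v_1, ..., v_n without repetitions: the labelling fixes the rows and
   columns of the adjacency matrix. The value of esign is relevant only on adjacent pairs. *)
record 'a signed_graph =
  verts :: "'a list"
  adj :: "'a \<Rightarrow> 'a \<Rightarrow> bool"
  esign :: "'a \<Rightarrow> 'a \<Rightarrow> int"

locale is_signed_graph =
  fixes S :: "'a signed_graph"
  assumes distinct_verts: "distinct (verts S)"
    and adj_verts: "adj S u v \<Longrightarrow> u \<in> set (verts S) \<and> v \<in> set (verts S)"
    and adj_irrefl: "\<not> adj S u u"
    and adj_sym: "adj S u v \<Longrightarrow> adj S v u"
    and esign_sym: "adj S u v \<Longrightarrow> esign S u v = esign S v u"
    and esign_range: "adj S u v \<Longrightarrow> esign S u v \<in> {-1, 1}"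

definition n_verts :: "'a signed_graph \<Rightarrow> nat" where
  "n_verts S = length (verts S)"

definition adj_matrix :: "'a signed_graph \<Rightarrow> real mat" where
  "adj_matrix S = mat (n_verts S) (n_verts S) (\<lambda>(i, j).
     if adj S (verts S ! i) (verts S ! j)
     then of_int (esign S (verts S ! i) (verts S ! j)) else 0)"

(* For a signed graph, adj_matrix S is real symmetric, so all its eigenvalues are real
   and no root of the characteristic polynomial is lost by working over the reals. *)
definition adj_spectrum :: "'a signed_graph \<Rightarrow> real multiset" where
  "adj_spectrum S = proots (char_poly (adj_matrix S))"

definition net_degree :: "'a signed_graph \<Rightarrow> 'a \<Rightarrow> int" where
  "net_degree S v =
     int (card {w. adj S v w \<and> esign S v w = 1}) - int (card {w. adj S v w \<and> esign S v w = -1})"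

definition net_regular :: "'a signed_graph \<Rightarrow> int \<Rightarrow> bool" where
  "net_regular S r \<longleftrightarrow> (\<forall>v \<in> set (verts S). net_degree S v = r)"

(* Inl v is the vertex v of S1, and Inr (v, u) is the vertex u in the copy of S2 belonging to v. *)
fun corona_adj :: "'a signed_graph \<Rightarrow> 'b signed_graph \<Rightarrow> 'a + 'a \<times> 'b \<Rightarrow> 'a + 'a \<times> 'b \<Rightarrow> bool" where
  "corona_adj S1 S2 (Inl v) (Inl w) \<longleftrightarrow> adj S1 v w"
| "corona_adj S1 S2 (Inl w) (Inr (v, u)) \<longleftrightarrow> adj S1 w v \<and> u \<in> set (verts S2)"
| "corona_adj S1 S2 (Inr (v, u)) (Inl w) \<longleftrightarrow> adj S1 w v \<and> u \<in> set (verts S2)"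
| "corona_adj S1 S2 (Inr (v, u)) (Inr (v', u')) \<longleftrightarrow> v = v' \<and> v \<in> set (verts S1) \<and> adj S2 u u'"

fun corona_sign :: "'a signed_graph \<Rightarrow> 'b signed_graph \<Rightarrow> 'a + 'a \<times> 'b \<Rightarrow> 'a + 'a \<times> 'b \<Rightarrow> int" where
  "corona_sign S1 S2 (Inl v) (Inl w) = esign S1 v w"
| "corona_sign S1 S2 (Inl w) (Inr (v, u)) = esign S1 w v"
| "corona_sign S1 S2 (Inr (v, u)) (Inl w) = esign S1 w v"
| "corona_sign S1 S2 (Inr (v, u)) (Inr (v', u')) = esign S2 u u'"

definition s_corona ::
    "'a signed_graph \<Rightarrow> 'b signed_graph \<Rightarrow> ('a + 'a \<times> 'b) signed_graph" (infixl "\<star>\<^sub>s" 70) where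
  "S1 \<star>\<^sub>s S2 =
     \<lparr> verts = map Inl (verts S1) @ map Inr (List.product (verts S1) (verts S2)),
       adj = corona_adj S1 S2,
       esign = corona_sign S1 S2 \<rparr>"

lemma n_verts_s_corona: "n_verts (S1 \<star>\<^sub>s S2) = n_verts S1 * (n_verts S2 + 1)"
  by (simp add: n_verts_def s_corona_def)

lemma is_signed_graph_s_corona:
  assumes "is_signed_graph S1" "is_signed_graph S2"
  shows "is_signed_graph (S1 \<star>\<^sub>s S2)"
proof -
  interpret S1: is_signed_graph S1 by fact
  interpret S2: is_signed_graph S2 by fact
  show ?thesis
  proof
    show "distinct (verts (S1 \<star>\<^sub>s S2))"
      using S1.distinct_verts S2.distinct_verts
      by (auto simp: s_corona_def distinct_map inj_on_def distinct_product)
    show "\<not> adj (S1 \<star>\<^sub>s S2) u u" for u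
      using S1.adj_irrefl S2.adj_irrefl
      by (cases "(S1, S2, u, u)" rule: corona_adj.cases) (auto simp: s_corona_def)
    fix x y assume "adj (S1 \<star>\<^sub>s S2) x y"
    then have *: "corona_adj S1 S2 x y" by (simp add: s_corona_def)
    show "x \<in> set (verts (S1 \<star>\<^sub>s S2)) \<and> y \<in> set (verts (S1 \<star>\<^sub>s S2))"
      using * S1.adj_verts S2.adj_verts
      by (cases "(S1, S2, x, y)" rule: corona_adj.cases) (auto simp: s_corona_def)
    show "adj (S1 \<star>\<^sub>s S2) y x"
      using * S1.adj_sym S2.adj_sym
      by (cases "(S1, S2, x, y)" rule: corona_adj.cases) (auto simp: s_corona_def)
    show "esign (S1 \<star>\<^sub>s S2) x y = esign (S1 \<star>\<^sub>s S2) y x"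
      using * S1.esign_sym S2.esign_sym
      by (cases "(S1, S2, x, y)" rule: corona_adj.cases) (auto simp: s_corona_def)
    show "esign (S1 \<star>\<^sub>s S2) x y \<in> {-1, 1}"
      using * S1.esign_range S2.esign_range
      by (cases "(S1, S2, x, y)" rule: corona_adj.cases) (auto simp: s_corona_def)
  qed
qed

end

(* Let A and B be the adjacency matrices of S1 and S2. The column operation that multiplies
   x I - A(S1 * S2) on the right by the lower block triangular matrix
   ((x - r2) I, 0; A (x) 1, I), where 1 is the all-ones column, clears the lower left block,
   because 1 is an eigenvector of B for r2. Taking determinants,
     p(x) (x - r2)^n1 = det ((x - r2) (x I - A) - n2 A^2) * p_B(x)^n1.
   For x > |r2| the matrix in the first factor splits as -n2 (A - a I) (A - b I) with real a, b,
   so its determinant is the product of (x - r2) (x - t) - n2 t^2 over the eigenvalues t of A.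
   Comparing the root multisets of both sides gives the spectrum. *)
theory Submission
  imports Defs
begin

section \<open>Sums over index pairs and determinants of block diagonal matrices\<close>

text \<open>Each index below \<open>n * m\<close> is \<open>a * m + b\<close> for unique
  \<open>a < n\<close> and \<open>b < m\<close>, so the range splits into \<open>n\<close> runs of
  length \<open>m\<close>. This evaluates matrix products whose inner index runs over all copies of
  the second graph.\<close>

lemma sum_div_mod:
  fixes f :: "nat \<Rightarrow> nat \<Rightarrow> 'a :: comm_monoid_add"
  shows "(\<Sum>l<n * m. f (l div m) (l mod m)) = (\<Sum>a<n. \<Sum>b<m. f a b)"
proof -
  have "(\<Sum>l<n * m. f (l div m) (l mod m)) =
      (\<Sum>a<n. \<Sum>l = a * m..<a * m + m. f (l div m) (l mod m))"
    by (rule sum.nat_group [symmetric])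
  also have "\<dots> = (\<Sum>a<n. \<Sum>b<m. f a b)"
  proof (rule sum.cong [OF refl])
    fix a
    have "(\<Sum>l = a * m..<a * m + m. f (l div m) (l mod m)) =
        (\<Sum>b = 0..<m. f ((b + a * m) div m) ((b + a * m) mod m))"
      using sum.shift_bounds_nat_ivl [of "\<lambda>l. f (l div m) (l mod m)" 0 "a * m" m]
      by (simp add: add.commute)
    also have "\<dots> = (\<Sum>b<m. f a b)"
      by (rule sum.cong) auto
    finally show "(\<Sum>l = a * m..<a * m + m. f (l div m) (l mod m)) = (\<Sum>b<m. f a b)" .
  qed
  finally show ?thesis .
qed

lemma mod_less_prod: "i < n * m \<Longrightarrow> i mod m < m" for i n m :: nat
  by (cases "m = 0") auto

text \<open>Dropping the first \<open>m\<close> rows and columns lowers every quotient by one and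
  keeps every remainder, so the matrix for \<open>Suc n\<close> is \<open>D\<close> followed by the
  matrix for \<open>n\<close> on the diagonal, with zeros elsewhere.\<close>

lemma det_repeated_diag_block:
  fixes D :: "'a :: idom mat"
  assumes D: "D \<in> carrier_mat m m"
  shows "det (mat (n * m) (n * m)
    (\<lambda>(i, j). if i div m = j div m then D $$ (i mod m, j mod m) else 0)) = det D ^ n"
proof (induction n)
  case 0
  show ?case by (simp add: det_dim_zero)
next
  case (Suc n)
  let ?K = "\<lambda>n. mat (n * m) (n * m)
    (\<lambda>(i, j). if i div m = j div m then D $$ (i mod m, j mod m) else 0)"
  have div_Suc: "i div m = Suc ((i - m) div m)" if "i < m + n * m" "\<not> i < m" for i
    using that by (cases "m = 0") (auto simp: le_div_geq)
  have mod_minus: "i mod m = (i - m) mod m" if "\<not> i < m" for i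
    using that by (simp add: le_mod_geq)
  have "?K (Suc n) = four_block_mat D (0\<^sub>m m (n * m)) (0\<^sub>m (n * m) m) (?K n)"
    using D by (intro eq_matI) (auto simp: div_Suc mod_minus)
  then show ?case
    using Suc.IH
      det_four_block_mat_lower_left_zero [OF D zero_carrier_mat refl mat_carrier, of "n * m"]
    by simp
qed

section \<open>Characteristic polynomials and multisets of roots\<close>

lemma poly_char_poly:
  fixes A :: "'a :: field mat"
  assumes "A \<in> carrier_mat n n"
  shows "poly (char_poly A) x = det (x \<cdot>\<^sub>m 1\<^sub>m n - A)"
proof -
  have "- char_matrix A x = x \<cdot>\<^sub>m 1\<^sub>m n - A"
    using assms by (intro eq_matI) (auto simp: char_matrix_def)
  then show ?thesis
    using char_poly_matrix [OF assms] by simp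
qed

text \<open>The size condition says that \<open>p\<close> splits, so linear factors can be divided
  off one at a time until the degree is 0. This recovers a characteristic polynomial from a spectrum
  given as a multiset.\<close>

lemma monic_eq_prod_proots:
  fixes p :: "'a :: idom poly"
  assumes "lead_coeff p = 1" and "size (proots p) = degree p"
  shows "p = (\<Prod>a\<in>#proots p. [:- a, 1:])"
  using assms
proof (induction "degree p" arbitrary: p)
  case 0
  then obtain c where "p = [:c:]"
    by (auto elim: degree_eq_zeroE)
  with 0 show ?case by (simp add: one_pCons)
next
  case (Suc d)
  then have p0: "p \<noteq> 0" by auto
  from Suc have "proots p \<noteq> {#}" by auto
  then obtain a where "a \<in># proots p" by blast
  with p0 have "poly p a = 0" by simp
  then obtain q where q: "p = [:- a, 1:] * q"
    by (auto simp: poly_eq_0_iff_dvd)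
  with p0 have q0: "q \<noteq> 0" by auto
  have pr: "proots p = add_mset a (proots q)"
    using q0 unfolding q by (subst proots_mult) auto
  have deg: "degree p = Suc (degree q)"
    using q0 unfolding q by (subst degree_mult_eq) auto
  have "lead_coeff q = 1"
    using Suc.prems(1) unfolding q lead_coeff_mult by simp
  then have "q = (\<Prod>a\<in>#proots q. [:- a, 1:])"
    using Suc.hyps(1) [of q] Suc.hyps(2) Suc.prems(2) pr deg by simp
  then show ?case
    unfolding pr by (simp add: q del: mult_pCons_left)
qed

text \<open>Otherwise the nonzero difference would vanish on a whole half-line, but it has only
  finitely many roots. This serves an identity that is proved for large arguments.\<close>

lemma poly_eqI_gt:
  fixes p q :: "real poly"
  assumes "\<And>x. x > c \<Longrightarrow> poly p x = poly q x"
  shows "p = q"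
proof (rule ccontr)
  assume "p \<noteq> q"
  then have "finite {x. poly (p - q) x = 0}"
    by (intro poly_roots_finite) simp
  moreover have "{c<..} \<subseteq> {x. poly (p - q) x = 0}"
    using assms by auto
  ultimately show False
    using infinite_Ioi finite_subset by blast
qed

lemma repeat_image_mset_set:
  "repeat_mset n (image_mset f (mset_set A)) = (\<Sum>a\<in>A. replicate_mset n (f a))"
  by (induction A rule: infinite_finite_induct) (auto simp: repeat_mset_distrib_add_mset)

section \<open>Determinants of a quadratic in a matrix and of the corona matrix\<close>

text \<open>The matrix is \<open>c\<close> times (aI - A)(bI - A), multiplied out; the scalar
  contributes \<open>c ^ n\<close>.\<close>

lemma det_quadratic:
  fixes A :: "'a :: field mat"
  assumes A: "A \<in> carrier_mat n n"
  shows "det ((c * a * b) \<cdot>\<^sub>m 1\<^sub>m n - (c * (a + b)) \<cdot>\<^sub>m A + c \<cdot>\<^sub>m (A * A)) =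
    c ^ n * poly (char_poly A) a * poly (char_poly A) b"
proof -
  let ?P = "a \<cdot>\<^sub>m 1\<^sub>m n - A" and ?Q = "b \<cdot>\<^sub>m 1\<^sub>m n - A"
  have P: "?P \<in> carrier_mat n n" and Q: "?Q \<in> carrier_mat n n"
    using A by auto
  have "?P * ?Q = ?P * (b \<cdot>\<^sub>m 1\<^sub>m n) - ?P * A"
    using A by (intro mult_minus_distrib_mat) auto
  also have "?P * A = a \<cdot>\<^sub>m A - A * A"
    using A by (subst minus_mult_distrib_mat) auto
  also have "?P * (b \<cdot>\<^sub>m 1\<^sub>m n) = b \<cdot>\<^sub>m ?P"
    using A P by (subst mult_smult_distrib) auto
  finally have PQ: "?P * ?Q = b \<cdot>\<^sub>m ?P - (a \<cdot>\<^sub>m A - A * A)" .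
  have "c \<cdot>\<^sub>m (?P * ?Q) = (c * a * b) \<cdot>\<^sub>m 1\<^sub>m n - (c * (a + b)) \<cdot>\<^sub>m A + c \<cdot>\<^sub>m (A * A)"
    unfolding PQ using A by (intro eq_matI) (auto simp: algebra_simps)
  moreover have "det (c \<cdot>\<^sub>m (?P * ?Q)) = c ^ n * (det ?P * det ?Q)"
    using A det_mult [OF P Q] by simp
  ultimately show ?thesis
    by (simp add: poly_char_poly [OF A] mult.assoc)
qed

(* The row (or column) index n + a * m + b stands for the vertex b in the a-th copy of the
   second graph. *)
definition corona_mat :: "'a :: comm_ring_1 mat \<Rightarrow> 'a mat \<Rightarrow> nat \<Rightarrow> nat \<Rightarrow> 'a mat" where
  "corona_mat A B n m = four_block_mat A
     (mat n (n * m) (\<lambda>(i, j). A $$ (i, j div m)))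
     (mat (n * m) n (\<lambda>(i, j). A $$ (i div m, j)))
     (mat (n * m) (n * m) (\<lambda>(i, j). if i div m = j div m then B $$ (i mod m, j mod m) else 0))"

lemma corona_mat_carrier:
  "A \<in> carrier_mat n n \<Longrightarrow> corona_mat A B n m \<in> carrier_mat (n + n * m) (n + n * m)"
  by (simp add: corona_mat_def)

text \<open>The factor \<open>(x - r) ^ n\<close> is the determinant of the column operation
  \<open>?T\<close>. Keeping it on the left, instead of dividing by it, makes the identity hold at
  \<open>x = r\<close> as well.\<close>

lemma poly_char_poly_corona_mat:
  fixes A B :: "'a :: field mat"
  assumes A: "A \<in> carrier_mat n n" and B: "B \<in> carrier_mat m m"
    and row_sum: "\<And>i. i < m \<Longrightarrow> (\<Sum>j<m. B $$ (i, j)) = r"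
  shows "poly (char_poly (corona_mat A B n m)) x * (x - r) ^ n =
    det ((x - r) \<cdot>\<^sub>m (x \<cdot>\<^sub>m 1\<^sub>m n - A) - of_nat m \<cdot>\<^sub>m (A * A)) * poly (char_poly B) x ^ n"
proof -
  let ?P = "x \<cdot>\<^sub>m 1\<^sub>m n - A"
  let ?E = "x \<cdot>\<^sub>m 1\<^sub>m m - B"
  let ?U = "mat n (n * m) (\<lambda>(i, j). - A $$ (i, j div m))"
  let ?L = "mat (n * m) n (\<lambda>(i, j). - A $$ (i div m, j))"
  let ?D = "mat (n * m) (n * m)
    (\<lambda>(i, j). if i div m = j div m then ?E $$ (i mod m, j mod m) else 0)"
  let ?V = "mat (n * m) n (\<lambda>(i, j). A $$ (i div m, j))"
  let ?s = "(x - r) \<cdot>\<^sub>m 1\<^sub>m n"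
  let ?T = "four_block_mat ?s (0\<^sub>m n (n * m)) ?V (1\<^sub>m (n * m))"
  let ?M = "four_block_mat ?P ?U ?L ?D"
  let ?Q = "(x - r) \<cdot>\<^sub>m ?P - of_nat m \<cdot>\<^sub>m (A * A)"
  \<comment> \<open>Quotient and remainder determine the index, so the diagonal of the large
    identity matrix falls exactly on the diagonals of the blocks \<open>?E\<close>.\<close>
  have div_mod: "i = j" if "i div m = j div m" "i mod m = j mod m" for i j
    using that by (metis div_mult_mod_eq)
  have mod_lt: "(i - n) mod m < m" if "i < n + n * m" "\<not> i < n" for i
    using that by (intro mod_less_prod [of _ n]) simp
  have M: "x \<cdot>\<^sub>m 1\<^sub>m (n + n * m) - corona_mat A B n m = ?M"
    using A B
    by (intro eq_matI) (auto simp: corona_mat_def mod_lt dest: div_mod)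
  \<comment> \<open>The summand depends only on the copy and not on the vertex within it, so each
    copy counts \<open>m\<close> times.\<close>
  have UV: "?U * ?V = - (of_nat m \<cdot>\<^sub>m (A * A))"
  proof (intro eq_matI)
    fix i j assume "i < dim_row (- (of_nat m \<cdot>\<^sub>m (A * A)))"
      and "j < dim_col (- (of_nat m \<cdot>\<^sub>m (A * A)))"
    with A have ij: "i < n" "j < n" by auto
    have "(?U * ?V) $$ (i, j) = (\<Sum>l<n * m. - A $$ (i, l div m) * A $$ (l div m, j))"
      using ij by (simp add: scalar_prod_def lessThan_atLeast0)
    also have "\<dots> = (\<Sum>a<n. \<Sum>b<m. - A $$ (i, a) * A $$ (a, j))"
      by (rule sum_div_mod [where f = "\<lambda>a b. - A $$ (i, a) * A $$ (a, j)"])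
    also have "\<dots> = (- (of_nat m \<cdot>\<^sub>m (A * A))) $$ (i, j)"
      using ij A by (simp add: scalar_prod_def lessThan_atLeast0 sum_distrib_left sum_negf)
    finally show "(?U * ?V) $$ (i, j) = (- (of_nat m \<cdot>\<^sub>m (A * A))) $$ (i, j)" .
  qed (use A in auto)
  have E_sum: "(\<Sum>b<m. ?E $$ (i, b)) = x - r" if "i < m" for i
  proof -
    have "(\<Sum>b<m. ?E $$ (i, b)) = (\<Sum>b<m. (if i = b then x else 0) - B $$ (i, b))"
      using that B by (intro sum.cong) auto
    also have "\<dots> = x - r"
      using that by (simp add: sum_subtractf row_sum)
    finally show ?thesis .
  qed
  \<comment> \<open>Each column of \<open>?V\<close> is constant on every copy, so \<open>?D\<close>
    multiplies it by the row sum \<open>x - r\<close> of \<open>?E\<close>. Since \<open>?L\<close>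
    is the negative of \<open>?V\<close>, the lower left block of \<open>?M * ?T\<close>
    cancels.\<close>
  have DV: "?D * ?V = - (?L * ?s)"
  proof (intro eq_matI)
    fix i j assume "i < dim_row (- (?L * ?s))" and "j < dim_col (- (?L * ?s))"
    then have ij: "i < n * m" "j < n" by auto
    note i = less_mult_imp_div_less [OF ij(1)] mod_less_prod [OF ij(1)]
    have "(?D * ?V) $$ (i, j) = (\<Sum>l<n * m. (if i div m = l div m
        then ?E $$ (i mod m, l mod m) else 0) * A $$ (l div m, j))"
      using ij by (simp add: scalar_prod_def lessThan_atLeast0)
    also have "\<dots> = (\<Sum>a<n. \<Sum>b<m. (if i div m = a
        then ?E $$ (i mod m, b) else 0) * A $$ (a, j))"
      by (rule sum_div_mod [where f = "\<lambda>a b. (if i div m = a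
        then ?E $$ (i mod m, b) else 0) * A $$ (a, j)"])
    also have "\<dots> = (\<Sum>a<n. if i div m = a then (x - r) * A $$ (a, j) else 0)"
      by (rule sum.cong) (auto simp: sum_distrib_right [symmetric] E_sum [OF i(2)])
    also have "\<dots> = (x - r) * A $$ (i div m, j)"
      using i(1) by simp
    also have "\<dots> = (- (?L * ?s)) $$ (i, j)"
      using ij by simp
    finally show "(?D * ?V) $$ (i, j) = (- (?L * ?s)) $$ (i, j)" .
  qed auto
  have Ps: "?P * ?s = (x - r) \<cdot>\<^sub>m ?P"
    using A by (subst mult_smult_distrib) auto
  have MT: "?M * ?T = four_block_mat ?Q ?U (0\<^sub>m (n * m) n) ?D"
  proof -
    have "?M * ?T = four_block_mat (?P * ?s + ?U * ?V) (?P * 0\<^sub>m n (n * m) + ?U * 1\<^sub>m (n * m))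
        (?L * ?s + ?D * ?V) (?L * 0\<^sub>m n (n * m) + ?D * 1\<^sub>m (n * m))"
      using A by (intro mult_four_block_mat) auto
    also have "?P * ?s + ?U * ?V = ?Q"
      unfolding Ps UV using A by (intro eq_matI) auto
    also have "?P * 0\<^sub>m n (n * m) + ?U * 1\<^sub>m (n * m) = ?U"
      using A by simp
    also have "?L * ?s + ?D * ?V = 0\<^sub>m (n * m) n"
      unfolding DV by (intro eq_matI) auto
    also have "?L * 0\<^sub>m n (n * m) + ?D * 1\<^sub>m (n * m) = ?D"
      by simp
    finally show ?thesis .
  qed
  have "det ?M * det ?T = det (?M * ?T)"
    using A by (intro det_mult [symmetric, of _ "n + n * m"]) auto
  also have "\<dots> = det ?Q * det ?D"
    unfolding MT using A by (intro det_four_block_mat_lower_left_zero) auto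
  also have "det ?D = det ?E ^ n"
    using B by (intro det_repeated_diag_block) auto
  also have "det ?T = (x - r) ^ n"
    using det_four_block_mat_upper_right_zero [of ?s n "0\<^sub>m n (n * m)" "n * m" ?V "1\<^sub>m (n * m)"]
    by simp
  finally show ?thesis
    using A B by (simp add: poly_char_poly [OF corona_mat_carrier [OF A]] poly_char_poly [OF B] M)
qed

section \<open>Adjacency matrices of signed graphs\<close>

lemma adj_matrix_carrier: "adj_matrix S \<in> carrier_mat (n_verts S) (n_verts S)"
  by (simp add: adj_matrix_def)

text \<open>In \<open>List.product\<close> the copy is the slow index, so position
  \<open>n + a * m + b\<close> of the corona's vertex list holds vertex \<open>b\<close> of copy
  \<open>a\<close>, in agreement with the indexing of \<open>corona_mat\<close>.\<close>

lemma adj_matrix_s_corona: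
  assumes S1: "is_signed_graph S1" and S2: "is_signed_graph S2"
  shows "adj_matrix (S1 \<star>\<^sub>s S2) =
    corona_mat (adj_matrix S1) (adj_matrix S2) (n_verts S1) (n_verts S2)"
proof -
  interpret S1: is_signed_graph S1 by fact
  interpret S2: is_signed_graph S2 by fact
  define n m where nm: "n = length (verts S1)" "m = length (verts S2)"
  define w where "w = verts (S1 \<star>\<^sub>s S2)"
  have corona: "adj (S1 \<star>\<^sub>s S2) = corona_adj S1 S2" "esign (S1 \<star>\<^sub>s S2) = corona_sign S1 S2"
    by (simp_all add: s_corona_def)
  have len: "length w = n + n * m"
    by (simp add: w_def s_corona_def nm)
  have w_Inl: "w ! i = Inl (verts S1 ! i)" if "i < n" for i
    using that by (simp add: w_def s_corona_def nth_append nm)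
  have w_Inr: "w ! i = Inr (verts S1 ! ((i - n) div m), verts S2 ! ((i - n) mod m))"
    if "i < n + n * m" "\<not> i < n" for i
    using that by (simp add: w_def s_corona_def nth_append nm product_nth)
  have idx: "(i - n) div m < n" "(i - n) mod m < m" if "i < n + n * m" "\<not> i < n" for i
    using that by (auto intro!: less_mult_imp_div_less mod_less_prod [of _ n])
  \<comment> \<open>The corona compares copies by their vertex of \<open>S1\<close>, the matrix by
    their index; distinctness makes the two agree.\<close>
  have nth_eq: "verts S1 ! a = verts S1 ! b \<longleftrightarrow> a = b" if "a < n" "b < n" for a b
    using that S1.distinct_verts by (simp add: nth_eq_iff_index_eq nm)
  show ?thesis
    unfolding corona_mat_def
  proof (intro eq_matI, goal_cases)
    case (1 i j)
    then have ij: "i < n + n * m" "j < n + n * m"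
      by (auto simp: adj_matrix_def n_verts_def nm)
    \<comment> \<open>In the lower left block the corona reads its pair of \<open>S1\<close>
      vertices in the order opposite to that of the matrix entry.\<close>
    have sym: "adj S1 u v \<longleftrightarrow> adj S1 v u" "adj S1 u v \<Longrightarrow> esign S1 v u = esign S1 u v" for u v
      using S1.adj_sym S1.esign_sym by auto
    have "adj_matrix (S1 \<star>\<^sub>s S2) $$ (i, j) =
        (if corona_adj S1 S2 (w ! i) (w ! j) then of_int (corona_sign S1 S2 (w ! i) (w ! j)) else 0)"
      using ij by (simp add: adj_matrix_def corona len n_verts_def flip: w_def)
    then show ?case
      using ij idx
      by (cases "i < n"; cases "j < n")
        (auto simp: adj_matrix_def w_Inl w_Inr nth_eq n_verts_def nm [symmetric] sym
          nth_mem [of _ "verts S1"] nth_mem [of _ "verts S2"])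
  qed (auto simp: adj_matrix_def len n_verts_def simp flip: w_def nm)
qed

text \<open>Every edge at a vertex adds its sign, 1 or -1, to that row, so the row sum is the
  net-degree. In other words, the all-ones vector is an eigenvector for \<open>r\<close>.\<close>

lemma adj_matrix_row_sum:
  assumes S: "is_signed_graph S" and "net_regular S r" and i: "i < n_verts S"
  shows "(\<Sum>j<n_verts S. adj_matrix S $$ (i, j)) = of_int r"
proof -
  interpret is_signed_graph S by fact
  let ?v = "verts S ! i"
  let ?g = "\<lambda>w. if adj S ?v w then of_int (esign S ?v w) else 0 :: real"
  let ?pos = "{w. adj S ?v w \<and> esign S ?v w = 1}" and ?neg = "{w. adj S ?v w \<and> esign S ?v w = -1}"
  \<comment> \<open>The sets counted in \<open>net_degree\<close> range over the whole type;
    adjacency confines them to the finite vertex set.\<close>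
  have sub: "?pos \<subseteq> set (verts S)" "?neg \<subseteq> set (verts S)"
    using adj_verts by auto
  have "(\<Sum>j<n_verts S. adj_matrix S $$ (i, j)) = (\<Sum>j<length (verts S). ?g (verts S ! j))"
    using i by (intro sum.cong) (auto simp: adj_matrix_def n_verts_def)
  also have "\<dots> = (\<Sum>w\<in>set (verts S). ?g w)"
    by (rule sum.reindex_bij_betw [OF bij_betw_nth [OF distinct_verts refl refl]])
  also have "\<dots> = (\<Sum>w\<in>set (verts S).
      (if w \<in> ?pos then 1 else 0) - (if w \<in> ?neg then 1 else 0))"
    using esign_range by (intro sum.cong) force+
  also have "\<dots> = real (card (set (verts S) \<inter> ?pos)) - real (card (set (verts S) \<inter> ?neg))"
    by (simp add: sum_subtractf sum.If_cases)
  also have "\<dots> = of_int (net_degree S ?v)"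
    using sub by (simp add: net_degree_def Int_absorb1)
  also have "net_degree S ?v = r"
    using assms i by (simp add: net_regular_def n_verts_def)
  finally show ?thesis .
qed

section \<open>Real quadratics and the spectrum of the corona\<close>

text \<open>The discriminant is nonnegative, so its square root gives an explicit factorization over
  the reals. A double root is listed twice.\<close>

lemma proots_quadratic:
  fixes b c :: real
  assumes "4 * c \<le> b\<^sup>2"
  shows "proots [:c, - b, 1:] = {# (b + sqrt (b\<^sup>2 - 4 * c)) / 2, (b - sqrt (b\<^sup>2 - 4 * c)) / 2 #}"
proof -
  let ?s = "sqrt (b\<^sup>2 - 4 * c)"
  have "?s * ?s = b\<^sup>2 - 4 * c"
    using assms by simp
  then have "[:c, - b, 1:] = [:- ((b + ?s) / 2), 1:] * [:- ((b - ?s) / 2), 1:]"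
    by (simp add: field_simps power2_eq_square)
  then show ?thesis
    by (simp add: proots_mult del: mult_pCons_left mult_pCons_right)
qed

theorem theorem2p3:
  fixes S1 :: "'a signed_graph" and S2 :: "'b signed_graph"
    and \<theta>1 \<theta>2 :: "nat \<Rightarrow> real" and r2 :: int and n1 n2 k :: nat
  assumes "is_signed_graph S1" and "n_verts S1 = n1"
    and "adj_spectrum S1 = image_mset \<theta>1 (mset_set {1..n1})"
    and "is_signed_graph S2" and "n_verts S2 = n2"
    and "net_regular S2 r2"
    and "adj_spectrum S2 = image_mset \<theta>2 (mset_set {1..n2})"
    and "1 \<le> k" and "k \<le> n2" and "\<theta>2 k = of_int r2"
  shows "adj_spectrum (S1 \<star>\<^sub>s S2) =
    (\<Sum>j \<in> {1..n2} - {k}. replicate_mset n1 (\<theta>2 j)) +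
    (\<Sum>i \<in> {1..n1}.
      {# (\<theta>1 i + r2 + sqrt ((1 + 4 * real n2) * (\<theta>1 i)\<^sup>2 + (r2 - 2 * \<theta>1 i) * r2)) / 2,
         (\<theta>1 i + r2 - sqrt ((1 + 4 * real n2) * (\<theta>1 i)\<^sup>2 + (r2 - 2 * \<theta>1 i) * r2)) / 2 #})"
proof -
  define A B where "A = adj_matrix S1" and "B = adj_matrix S2"
  define r where "r = real_of_int r2"
  define p where "p = char_poly (corona_mat A B n1 n2)"
  \<comment> \<open>As a polynomial in x, \<open>q t\<close> is (x - r)(x - t) - n2 t^2; its two
    roots are the eigenvalues in (ii) for t.\<close>
  define q where "q = (\<lambda>t. [:r * t - real n2 * t\<^sup>2, - (t + r), 1:])"
  have A: "A \<in> carrier_mat n1 n1" and B: "B \<in> carrier_mat n2 n2"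
    using adj_matrix_carrier assms(2,5) unfolding A_def B_def by blast+
  have p0: "p \<noteq> 0"
    using degree_monic_char_poly [OF corona_mat_carrier [OF A, of B n2]] by (force simp: p_def)
  have pB0: "char_poly B \<noteq> 0"
    using degree_monic_char_poly [OF B] by force
  have q0: "q t \<noteq> 0" for t
    by (simp add: q_def)
  \<comment> \<open>The given spectrum has \<open>n1\<close> members, which is the degree, so the
    characteristic polynomial of \<open>A\<close> splits over the reals.\<close>
  have "size (proots (char_poly A)) = n1"
    using assms(3) by (simp add: adj_spectrum_def A_def)
  then have "char_poly A = (\<Prod>a\<in>#proots (char_poly A). [:- a, 1:])"
    using degree_monic_char_poly [OF A] by (intro monic_eq_prod_proots) auto
  also have "\<dots> = (\<Prod>i\<in>{1..n1}. [:- \<theta>1 i, 1:])"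
    using assms(3) by (simp add: adj_spectrum_def A_def prod_unfold_prod_mset multiset.map_comp o_def)
  finally have poly_A: "poly (char_poly A) a = (\<Prod>i\<in>{1..n1}. a - \<theta>1 i)" for a
    by (simp add: poly_prod)
  have eval: "poly (p * [:- r, 1:] ^ n1) x = poly (char_poly B ^ n1 * (\<Prod>i\<in>{1..n1}. q (\<theta>1 i))) x"
    if x: "x > \<bar>r\<bar>" for x
  proof -
    define N where "N = real n2"
    define d where "d = sqrt ((x - r)\<^sup>2 + 4 * N * ((x - r) * x))"
    \<comment> \<open>These are the roots of N z^2 + (x - r) z - (x - r) x, the negative of the
      quadratic in \<open>A\<close> whose determinant is sought. The index \<open>k\<close> forces
      \<open>n2\<close> to be at least 1, so the denominator is positive.\<close>
    define a b where "a = (- (x - r) + d) / (2 * N)" and "b = (- (x - r) - d) / (2 * N)"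
    have N: "N > 0"
      using assms(8,9) by (simp add: N_def)
    \<comment> \<open>Here \<open>x > \<bar>r\<bar>\<close> enters: it makes the radicand of
      \<open>d\<close> nonnegative, so that \<open>a\<close> and \<open>b\<close> are real
      roots.\<close>
    have "(x - r) * x \<ge> 0"
      using x by (intro mult_nonneg_nonneg) auto
    then have d: "d * d = (x - r)\<^sup>2 + 4 * N * ((x - r) * x)"
      using N by (simp add: d_def)
    have "- N * (a + b) = x - r"
      using N by (simp add: a_def b_def field_simps)
    moreover have "- N * a * b = (d * d - (x - r)\<^sup>2) / (4 * N)"
      using N by (simp add: a_def b_def field_simps power2_eq_square)
    then have "- N * a * b = (x - r) * x"
      using N unfolding d by simp
    ultimately have ab: "- N * (a + b) = x - r" "- N * a * b = (x - r) * x" .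
    have "(x - r) \<cdot>\<^sub>m (x \<cdot>\<^sub>m 1\<^sub>m n1 - A) - N \<cdot>\<^sub>m (A * A) =
        (- N * a * b) \<cdot>\<^sub>m 1\<^sub>m n1 - (- N * (a + b)) \<cdot>\<^sub>m A + (- N) \<cdot>\<^sub>m (A * A)"
      unfolding ab using A by (intro eq_matI) (auto simp: algebra_simps)
    then have "det ((x - r) \<cdot>\<^sub>m (x \<cdot>\<^sub>m 1\<^sub>m n1 - A) - N \<cdot>\<^sub>m (A * A)) =
        (- N) ^ n1 * (\<Prod>i\<in>{1..n1}. a - \<theta>1 i) * (\<Prod>i\<in>{1..n1}. b - \<theta>1 i)"
      using det_quadratic [OF A] by (simp only: poly_A)
    also have "\<dots> = (\<Prod>i\<in>{1..n1}. - N * (a - \<theta>1 i) * (b - \<theta>1 i))"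
      by (simp only: prod.distrib) simp
    \<comment> \<open>\<open>a\<close> and \<open>b\<close> enter each factor only through their sum
      and product, which are rational in x; so the square root \<open>d\<close> disappears.\<close>
    also have "\<dots> = (\<Prod>i\<in>{1..n1}. poly (q (\<theta>1 i)) x)"
    proof (rule prod.cong [OF refl])
      fix i
      let ?t = "\<theta>1 i"
      have "- N * (a - ?t) * (b - ?t) = - N * a * b - (- N * (a + b)) * ?t - N * ?t\<^sup>2"
        by (simp add: algebra_simps power2_eq_square)
      also have "\<dots> = poly (q ?t) x"
        unfolding ab by (simp add: q_def N_def algebra_simps power2_eq_square)
      finally show "- N * (a - ?t) * (b - ?t) = poly (q ?t) x" .
    qed
    finally have "det ((x - r) \<cdot>\<^sub>m (x \<cdot>\<^sub>m 1\<^sub>m n1 - A) - N \<cdot>\<^sub>m (A * A)) =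
      (\<Prod>i\<in>{1..n1}. poly (q (\<theta>1 i)) x)" .
    moreover have "(\<Sum>j<n2. B $$ (i, j)) = r" if "i < n2" for i
      using adj_matrix_row_sum [OF assms(4,6)] that assms(5) by (simp add: B_def r_def)
    ultimately show ?thesis
      using poly_char_poly_corona_mat [OF A B, of r x]
      by (simp add: p_def N_def poly_prod)
  qed
  have "p * [:- r, 1:] ^ n1 = char_poly B ^ n1 * (\<Prod>i\<in>{1..n1}. q (\<theta>1 i))"
  proof (rule poly_eqI_gt)
    show "poly (p * [:- r, 1:] ^ n1) x = poly (char_poly B ^ n1 * (\<Prod>i\<in>{1..n1}. q (\<theta>1 i))) x"
      if "x > \<bar>r\<bar>" for x
      using that by (rule eval)
  qed
  then have "proots (p * [:- r, 1:] ^ n1) =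
      proots (char_poly B ^ n1 * (\<Prod>i\<in>{1..n1}. q (\<theta>1 i)))"
    by (rule arg_cong)
  moreover have "proots (p * [:- r, 1:] ^ n1) = proots p + replicate_mset n1 r"
    using p0 by (simp add: proots_mult proots_power)
  moreover have "proots (char_poly B ^ n1 * (\<Prod>i\<in>{1..n1}. q (\<theta>1 i))) =
      repeat_mset n1 (proots (char_poly B)) + (\<Sum>i\<in>{1..n1}. proots (q (\<theta>1 i)))"
    using q0 pB0 by (simp add: proots_mult proots_power proots_prod)
  \<comment> \<open>The \<open>n1\<close> copies of \<open>\<theta>2 k = r2\<close> are split off so
    that they cancel the root \<open>r\<close> of multiplicity \<open>n1\<close> contributed by the
    column operation.\<close>
  moreover have "repeat_mset n1 (proots (char_poly B)) =
      (\<Sum>j \<in> {1..n2} - {k}. replicate_mset n1 (\<theta>2 j)) + replicate_mset n1 r"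
  proof -
    have "repeat_mset n1 (proots (char_poly B)) = (\<Sum>j\<in>{1..n2}. replicate_mset n1 (\<theta>2 j))"
      using assms(7) by (simp add: adj_spectrum_def B_def repeat_image_mset_set)
    also have "\<dots> = (\<Sum>j\<in>{1..n2} - {k}. replicate_mset n1 (\<theta>2 j)) + replicate_mset n1 r"
      using assms(8-10) by (subst sum.remove [of _ k]) (auto simp: r_def add.commute)
    finally show ?thesis .
  qed
  ultimately have "proots p = (\<Sum>j \<in> {1..n2} - {k}. replicate_mset n1 (\<theta>2 j)) +
      (\<Sum>i\<in>{1..n1}. proots (q (\<theta>1 i)))"
    by simp
  moreover have "proots (q t) =
      {# (t + r2 + sqrt ((1 + 4 * real n2) * t\<^sup>2 + (r2 - 2 * t) * r2)) / 2,
         (t + r2 - sqrt ((1 + 4 * real n2) * t\<^sup>2 + (r2 - 2 * t) * r2)) / 2 #}" for t :: real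
  proof -
    have *: "(t + r)\<^sup>2 - 4 * (r * t - real n2 * t\<^sup>2) = (1 + 4 * real n2) * t\<^sup>2 + (r - 2 * t) * r"
      by (simp add: algebra_simps power2_eq_square)
    \<comment> \<open>Regrouping the discriminant of \<open>q t\<close> as a sum of squares shows
      that it is nonnegative.\<close>
    have "(t + r)\<^sup>2 - 4 * (r * t - real n2 * t\<^sup>2) = (t - r)\<^sup>2 + 4 * real n2 * t\<^sup>2"
      by (simp add: algebra_simps power2_eq_square)
    also have "\<dots> \<ge> 0" by simp
    finally have "4 * (r * t - real n2 * t\<^sup>2) \<le> (t + r)\<^sup>2" by simp
    from proots_quadratic [OF this] show ?thesis
      unfolding * by (simp only: q_def r_def)
  qed
  ultimately show ?thesis
    using adj_matrix_s_corona [OF assms(1,4)] assms(2,5)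
    by (simp only: adj_spectrum_def p_def A_def B_def)
qed

end
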